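(* For all integers $k\geq 4$, $l\geq 10$ and $r\geq 1$, $$\operatorname{bgr}_k(P_5:rP_l)=kr\lfloor l/2\rfloor-k+1.$$
   Context: All graphs are finite, simple and undirected. $P_n$ denotes the path on $n$ vertices, and $rG$ denotes the union of $r$ vertex-disjoint copies of $G$. A $k$-edge-coloring (not necessarily proper) is exact if all $k$ colors are used at least once. A copy of a graph in an edge-colored graph is a (not necessarily induced) subgraph isomorphic to it; it is rainbow if no two of its edges have the same color and monochromatic if all its edges have the same color. The $k$-colored bipartite Gallai-Ramsey number $\operatorname{bgr}_k(G:H)$ is the minimum integer $n$ such that $n^2\geq k$ and for every $N\geq n$, every exact $k$-edge-coloring of the complete bipartite graph $K_{N,N}$ contains either a rainbow copy of $G$ or a monochromatic copy of $H$. *)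

theory Defs
  imports "HOL-Library.Extended_Nat"
begin

record 'a ugraph =
  verts :: "'a set"
  edges :: "'a set set"

definition simple_graph :: "'a ugraph \<Rightarrow> bool" where
  "simple_graph G \<longleftrightarrow> finite (verts G) \<and> (\<forall>e \<in> edges G. e \<subseteq> verts G \<and> card e = 2)"

definition subgraph_of :: "'a ugraph \<Rightarrow> 'a ugraph \<Rightarrow> bool" where
  "subgraph_of S G \<longleftrightarrow> simple_graph S \<and> verts S \<subseteq> verts G \<and> edges S \<subseteq> edges G"

definition isomorphic :: "'a ugraph \<Rightarrow> 'b ugraph \<Rightarrow> bool" where
  "isomorphic G H \<longleftrightarrow>
     (\<exists>f. bij_betw f (verts G) (verts H) \<and> (\<lambda>e. f ` e) ` edges G = edges H)"

definition is_copy :: "'a ugraph \<Rightarrow> 'b ugraph \<Rightarrow> 'a ugraph \<Rightarrow> bool" where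
  "is_copy S H G \<longleftrightarrow> subgraph_of S G \<and> isomorphic S H"

definition path_graph :: "nat \<Rightarrow> nat ugraph" where
  "path_graph n = \<lparr>verts = {..<n}, edges = {{i, Suc i} | i. Suc i < n}\<rparr>"

definition disjoint_copies :: "nat \<Rightarrow> 'a ugraph \<Rightarrow> (nat \<times> 'a) ugraph" where
  "disjoint_copies r G =
     \<lparr>verts = {..<r} \<times> verts G, edges = {Pair i ` e | i e. i < r \<and> e \<in> edges G}\<rparr>"

definition complete_bipartite :: "nat \<Rightarrow> nat \<Rightarrow> (nat + nat) ugraph" where
  "complete_bipartite m n =
     \<lparr>verts = {..<m} <+> {..<n}, edges = {{Inl i, Inr j} | i j. i < m \<and> j < n}\<rparr>"

text \<open>
  An edge-coloring is a function on all vertex sets; only its values on the edges matter.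
\<close>

definition exact_coloring :: "nat \<Rightarrow> 'a ugraph \<Rightarrow> ('a set \<Rightarrow> nat) \<Rightarrow> bool" where
  "exact_coloring k G c \<longleftrightarrow> c ` edges G = {1..k}"

definition rainbow :: "('a set \<Rightarrow> nat) \<Rightarrow> 'a ugraph \<Rightarrow> bool" where
  "rainbow c S \<longleftrightarrow> inj_on c (edges S)"

definition monochromatic :: "('a set \<Rightarrow> nat) \<Rightarrow> 'a ugraph \<Rightarrow> bool" where
  "monochromatic c S \<longleftrightarrow> (\<exists>x. \<forall>e \<in> edges S. c e = x)"

definition bgr_bound :: "nat \<Rightarrow> 'a ugraph \<Rightarrow> 'b ugraph \<Rightarrow> nat \<Rightarrow> bool" where
  "bgr_bound k G H n \<longleftrightarrow> n\<^sup>2 \<ge> k \<and>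
     (\<forall>N \<ge> n. \<forall>c. exact_coloring k (complete_bipartite N N) c \<longrightarrow>
        (\<exists>S. is_copy S G (complete_bipartite N N) \<and> rainbow c S) \<or>
        (\<exists>S. is_copy S H (complete_bipartite N N) \<and> monochromatic c S))"

text \<open>
  The value is an extended natural number: it is \<open>\<infinity>\<close> if no bound exists, so an equation
  \<open>bgr k G H = enat m\<close> says that the minimum exists and equals \<open>m\<close>
  (see \<open>bgr_eq_enat_iff\<close> below).
\<close>

definition bgr :: "nat \<Rightarrow> 'a ugraph \<Rightarrow> 'b ugraph \<Rightarrow> enat" where
  "bgr k G H = (INF n \<in> {n. bgr_bound k G H n}. enat n)"

lemma bgr_eq_enat_iff:
  "bgr k G H = enat m \<longleftrightarrow> bgr_bound k G H m \<and> (\<forall>n. bgr_bound k G H n \<longrightarrow> m \<le> n)"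
proof
  let ?A = "enat ` {n. bgr_bound k G H n}"
  assume eq: "bgr k G H = enat m"
  have "?A \<noteq> {}"
  proof
    assume "?A = {}"
    with eq have "Inf {} = enat m" by (simp only: bgr_def)
    then show False by (simp add: Inf_enat_def)
  qed
  then have "Inf ?A \<in> ?A"
    unfolding Inf_enat_def by (metis (mono_tags, lifting) LeastI ex_in_conv)
  with eq have "bgr_bound k G H m" by (auto simp: bgr_def)
  moreover have "m \<le> n" if "bgr_bound k G H n" for n
  proof -
    have "bgr k G H \<le> enat n"
      unfolding bgr_def using that by (intro INF_lower) simp
    with eq show ?thesis by simp
  qed
  ultimately show "bgr_bound k G H m \<and> (\<forall>n. bgr_bound k G H n \<longrightarrow> m \<le> n)" by blast
next
  assume *: "bgr_bound k G H m \<and> (\<forall>n. bgr_bound k G H n \<longrightarrow> m \<le> n)"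
  show "bgr k G H = enat m"
    unfolding bgr_def
  proof (rule antisym)
    show "(INF n \<in> {n. bgr_bound k G H n}. enat n) \<le> enat m"
      using * by (intro INF_lower) simp
    show "enat m \<le> (INF n \<in> {n. bgr_bound k G H n}. enat n)"
      using * by (intro INF_greatest) simp
  qed
qed

lemma simple_graph_path_graph: "simple_graph (path_graph n)"
  by (auto simp: simple_graph_def path_graph_def)

lemma simple_graph_complete_bipartite: "simple_graph (complete_bipartite m n)"
  by (auto simp: simple_graph_def complete_bipartite_def)

lemma simple_graph_disjoint_copies:
  assumes "simple_graph G"
  shows "simple_graph (disjoint_copies r G)"
proof -
  have "card (Pair i ` e) = card e" for i :: nat and e :: "'a set"
    by (rule card_image) (simp add: inj_on_def)
  with assms show ?thesis
    by (auto simp: simple_graph_def disjoint_copies_def)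
qed

end

theory Submission
  imports Defs
begin

text \<open>
  Write \<open>p = r * (l div 2)\<close>, the number of vertices that \<open>r\<close> disjoint copies of \<open>P\<^sub>l\<close> have
  at least on each side of a bipartite graph. The claimed value is \<open>k * (p - 1) + 1\<close>.

  Lower bound. Let the colour of an edge be determined by its right endpoint, with \<open>p - 1\<close> right
  vertices for each of the \<open>k\<close> colours. A path on five vertices has two consecutive edges that
  meet in a right vertex and hence have the same colour, so it is not rainbow, and a monochromatic
  copy of \<open>r P\<^sub>l\<close> would need \<open>p\<close> right vertices of one colour.

  Upper bound. View a colouring of the complete bipartite graph on \<open>A\<close> and \<open>B\<close> as a matrix with
  rows \<open>A\<close> and columns \<open>B\<close>, and suppose that it has no rainbow \<open>P\<^sub>5\<close> and at least four colours.

  If some row \<open>u\<close> has three colours, then every row either equals row \<open>u\<close> or is constant, with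
  the same constant \<open>p\<^sub>0\<close> for all of the latter (\<open>rows_conform_or_constant\<close>). When many rows
  equal row \<open>u\<close>, the pigeonhole principle gives \<open>p\<close> columns on which all these rows have one
  common colour; otherwise many rows are constant. In both cases there is a monochromatic
  complete bipartite subgraph large enough to contain \<open>r P\<^sub>l\<close>. A column with three colours is
  treated in the same way.

  If every row and every column has at most two colours, then there is a colour \<open>x\<close> such that every
  line has, apart from \<open>x\<close>, at most one colour (\<open>common_colour_of_2_coloured_lines\<close>). Hence a path
  that avoids \<open>x\<close> is monochromatic. A depth-first search in the graph of the edges not coloured
  \<open>x\<close> finds either a path on \<open>r * l\<close> vertices, which contains \<open>r P\<^sub>l\<close>, or two large sets on
  opposite sides with only \<open>x\<close>-coloured edges between them (\<open>path_with_separated_remainder\<close>).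
\<close>

section \<open>Cardinality\<close>

lemma ex_distinct_of_card_ge_2:
  assumes "2 \<le> card X" shows "\<exists>x\<in>X. \<exists>y\<in>X. x \<noteq> y"
proof -
  have "X \<noteq> {}" using assms by auto
  then obtain x where x: "x \<in> X" by auto
  have "X \<noteq> {x}" using assms by auto
  then show ?thesis using x by blast
qed

lemma card_minus_singleton_ge:
  assumes "n \<le> card X" shows "n - 1 \<le> card (X - {x})"
  using assms by (auto simp: card_Diff_singleton_if)

lemma third_element_of_card_le_2:
  assumes "card X \<le> 2" "finite X" "x \<in> X" "y \<in> X" "z \<in> X" "x \<noteq> y"
  shows "z = x \<or> z = y"
proof (rule ccontr)
  assume "\<not> ?thesis"
  then have "card {x, y, z} = 3" using assms(6) by auto
  moreover have "card {x, y, z} \<le> card X" using assms by (intro card_mono) auto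
  ultimately show False using assms(1) by simp
qed

section \<open>Colour matrices without rainbow paths on five vertices\<close>

text \<open>
  The four entries are the colours of the edges of a path on the vertices
  \<open>a, b, a', b', a''\<close>, which starts and ends in \<open>A\<close>.
\<close>

definition rainbow_P5_free_from :: "'a set \<Rightarrow> 'b set \<Rightarrow> ('a \<Rightarrow> 'b \<Rightarrow> 'c) \<Rightarrow> bool" where
  "rainbow_P5_free_from A B M \<longleftrightarrow>
     (\<forall>a\<in>A. \<forall>b\<in>B. \<forall>a'\<in>A. \<forall>b'\<in>B. \<forall>a''\<in>A. distinct [a, a', a''] \<longrightarrow> b \<noteq> b' \<longrightarrow>
        \<not> distinct [M a b, M a' b, M a' b', M a'' b'])"

definition rainbow_P5_free :: "'a set \<Rightarrow> 'b set \<Rightarrow> ('a \<Rightarrow> 'b \<Rightarrow> 'c) \<Rightarrow> bool" where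
  "rainbow_P5_free A B M \<longleftrightarrow>
     rainbow_P5_free_from A B M \<and> rainbow_P5_free_from B A (\<lambda>b a. M a b)"

lemma rainbow_P5_free_transpose:
  "rainbow_P5_free A B M \<Longrightarrow> rainbow_P5_free B A (\<lambda>b a. M a b)"
  by (simp add: rainbow_P5_free_def)

lemma no_rainbow_outer_rows:
  assumes "rainbow_P5_free A B M" "distinct [M a b, M a' b, M a' b', M a'' b']" "a \<noteq> a''"
    "a \<in> A" "a' \<in> A" "a'' \<in> A" "b \<in> B" "b' \<in> B"
  shows False
proof -
  have "distinct [a, a', a'']" "b \<noteq> b'" using assms(2,3) by auto
  then show False
    using assms unfolding rainbow_P5_free_def rainbow_P5_free_from_def by blast
qed

lemma no_rainbow_outer_columns:
  assumes "rainbow_P5_free A B M" "distinct [M a b, M a b', M a' b', M a' b'']" "b \<noteq> b''"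
    "a \<in> A" "a' \<in> A" "b \<in> B" "b' \<in> B" "b'' \<in> B"
  shows False
  using no_rainbow_outer_rows[OF rainbow_P5_free_transpose[OF assms(1)]] assms by blast

text \<open>
  Write \<open>i\<close> and \<open>p\<close> for the entries of the rows \<open>u\<close> and \<open>w\<close> in column \<open>v\<close>, and suppose that row
  \<open>u\<close> has two further colours. Suppose that row \<open>w\<close> has a third entry \<open>q\<close> in a column
  \<open>v'\<close>. Paths through \<open>v'\<close>, \<open>w\<close>, \<open>v\<close>, \<open>u\<close> and similar ones show that every colour of row \<open>u\<close>
  other than \<open>p\<close> is \<open>i\<close>, \<open>q\<close> or the entry \<open>j\<close> in column \<open>v'\<close>, and that these three occur in one
  column each. At least two of five columns are left; they have colour \<open>p\<close> in row \<open>u\<close>, and they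
  complete a rainbow path. So row \<open>w\<close> lies in \<open>{i, p}\<close>, and then the entry \<open>i\<close> is excluded by
  paths through two columns in which row \<open>u\<close> has further colours.
\<close>

lemma deviating_row_constant:
  fixes M :: "'a \<Rightarrow> 'b \<Rightarrow> 'c"
  assumes free: "rainbow_P5_free A B M" and B: "card B \<ge> 5"
    and u: "u \<in> A" and w: "w \<in> A" and v: "v \<in> B"
    and dev: "M w v \<noteq> M u v"
    and two: "card (M u ` B - {M u v, M w v}) \<ge> 2"
  shows "\<forall>x\<in>B. M w x = M w v"
proof -
  note R = no_rainbow_outer_columns[OF free _ _ _ _ _ _ _]
  define i p where "i = M u v" and "p = M w v"
  have ip: "i \<noteq> p" using dev by (simp add: i_def p_def)
  note ipd = i_def[symmetric] p_def[symmetric]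
  have row: "M w v' \<in> {i, p}" if v': "v' \<in> B" for v'
  proof (rule ccontr)
    assume neg: "M w v' \<notin> {i, p}"
    define q where "q = M w v'"
    have q: "q \<noteq> i" "q \<noteq> p" using neg by (auto simp: q_def)
    have vv': "v \<noteq> v'" using q by (auto simp: q_def p_def)
    note eqs = i_def[symmetric] p_def[symmetric] q_def[symmetric]
    \<comment> \<open>The path \<open>x, u, v, w, v'\<close> has colours \<open>M u x, i, p, q\<close>.\<close>
    have only: "x = v'" if "x \<in> B" "M u x \<notin> {i, p, q}" for x
      using R[of u x v w v'] that q ip vv' u v w v' by (auto simp: eqs)
    obtain s t where st: "s \<in> M u ` B - {i, p}" "t \<in> M u ` B - {i, p}" "s \<noteq> t"
      using ex_distinct_of_card_ge_2[OF two] unfolding ipd by blast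
    define j where "j = M u v'"
    note eqs = eqs j_def[symmetric]
    \<comment> \<open>Of the two further colours of row \<open>u\<close>, one occurs only in column \<open>v'\<close>, so the other is \<open>q\<close>.\<close>
    obtain x where x: "x \<in> B" "M u x = q" and j: "j \<notin> {i, p, q}"
    proof -
      have "s = q \<or> s = j" "t = q \<or> t = j"
        using st only by (auto simp: j_def)
      then show ?thesis using st that by auto
    qed
    have ne: "v \<noteq> x" "v' \<noteq> x" using x j q by (auto simp: i_def j_def)
    have fi: "y = v" if "y \<in> B" "M u y = i" for y
    proof (rule ccontr)
      assume "y \<noteq> v"
      then show False using R[of w v v' u y] that j q ip u v w v' by (auto simp: eqs)
    qed
    have "M w x \<in> {j, i, p}"
      by (rule ccontr) (use R[of u v' v w x] x j q ip vv' ne u v w v' in \<open>auto simp: eqs\<close>)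
    moreover have "M w x \<in> {j, q, p}"
      by (rule ccontr) (use R[of u v' x w v] x j q ip vv' ne u v w v' in \<open>auto simp: eqs\<close>)
    moreover have "M w x \<in> {q, j, i}"
      by (rule ccontr) (use R[of w x v' u v] x j q ip vv' ne u v w v' in \<open>auto simp: eqs\<close>)
    ultimately have sx: "M w x = j" using q ip by blast
    have fq: "y = x" if "y \<in> B" "M u y = q" for y
    proof (rule ccontr)
      assume "y \<noteq> x"
      then show False
        using R[of w x v u y] that sx x j q ip ne u v w v' by (auto simp: eqs)
    qed
    have "card (B - {v} - {v'} - {x}) \<ge> 2"
      using card_minus_singleton_ge[OF card_minus_singleton_ge[OF card_minus_singleton_ge[OF B]], of v v' x]
      by simp
    then obtain y y' where y: "y \<in> B - {v} - {v'} - {x}" "y' \<in> B - {v} - {v'} - {x}" "y \<noteq> y'"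
      using ex_distinct_of_card_ge_2 by blast
    \<comment> \<open>All colours of row \<open>u\<close> other than \<open>p\<close> are used up by the columns \<open>v\<close>, \<open>v'\<close> and \<open>x\<close>.\<close>
    have fp: "M u y = p" "M u y' = p" using y only fi fq by blast+
    have "M w y \<in> {j, i, p}"
      by (rule ccontr) (use R[of u v' v w y] x y fp j q ip vv' u v w v' in \<open>auto simp: eqs\<close>)
    moreover have "M w y \<in> {p, i, q}"
      by (rule ccontr) (use R[of w y v u x] x y fp j q ip vv' u v w v' in \<open>auto simp: eqs\<close>)
    moreover have "M w y \<in> {q, j, i}"
      by (rule ccontr) (use R[of w y v' u v] x y fp j q ip vv' u v w v' in \<open>auto simp: eqs\<close>)
    ultimately have "M w y = i" using q ip j by blast
    then show False
      using R[of w y v' u y'] x y fp j q ip u v w v' by (auto simp: eqs)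
  qed
  obtain s t where "s \<in> M u ` B - {i, p}" "t \<in> M u ` B - {i, p}" "s \<noteq> t"
    using ex_distinct_of_card_ge_2[OF two] unfolding ipd by blast
  then obtain x y where x: "x \<in> B" "M u x \<notin> {i, p}" and y: "y \<in> B" "M u y \<notin> {i, p}"
    and xy: "M u x \<noteq> M u y" by auto
  have vxy: "v \<noteq> x" "v \<noteq> y" using x y by (auto simp: i_def)
  have "M w x = p"
    using vxy R[of w v x u y] row[of x] x y xy ip u v w by (auto simp: ipd)
  moreover have "M w y = p"
    using vxy R[of w v y u x] row[of y] x y xy ip u v w by (auto simp: ipd)
  moreover have "M w z = p" if z: "z \<in> B" and wxy: "M w x = p" "M w y = p" for z
  proof (rule ccontr)
    assume "M w z \<noteq> p"
    then have "M w z = i" "z \<noteq> y" using row[OF z] wxy by auto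
    then show False using R[of w z x u y] z wxy x y xy ip u w by auto
  qed
  ultimately have "M w z = p" if "z \<in> B" for z using that by blast
  then show ?thesis by (simp add: p_def)
qed

text \<open>
  Some row \<open>w0\<close> different from row \<open>u\<close> is constant, with a colour \<open>p\<close> that leaves three more
  colours in row \<open>u\<close>: if row \<open>u\<close> has four colours, any row that differs from row \<open>u\<close> will do, and
  otherwise a row in which a fourth colour occurs. Paths from \<open>w0\<close> through \<open>u\<close> to a
  third row then allow that row to deviate from row \<open>u\<close> only by being constant with the same
  colour.
\<close>

lemma rows_conform_or_constant:
  fixes M :: "'a \<Rightarrow> 'b \<Rightarrow> 'c"
  assumes free: "rainbow_P5_free A B M" and B: "card B \<ge> 5"
    and u: "u \<in> A" and three: "card (M u ` B) \<ge> 3"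
    and four: "card (case_prod M ` (A \<times> B)) \<ge> 4"
  shows "\<exists>p. \<forall>w\<in>A. (\<forall>v\<in>B. M w v = M u v) \<or> (\<forall>v\<in>B. M w v = p)"
proof (cases "\<forall>w\<in>A. \<forall>v\<in>B. M w v = M u v")
  case True
  then show ?thesis by blast
next
  case False
  note R = no_rainbow_outer_rows[OF free _ _ _ _ _ _ _]
  note const = deviating_row_constant[OF free B u]
  have minus: "card (M u ` B - {s, t}) \<ge> n - 1" if "card (M u ` B - {s}) \<ge> n" for n s t
  proof -
    have "M u ` B - {s, t} = M u ` B - {s} - {t}" by blast
    then show ?thesis using card_minus_singleton_ge[OF that, of t] by simp
  qed
  have "\<exists>w0\<in>A. \<exists>p. (\<forall>v\<in>B. M w0 v = p) \<and> card (M u ` B - {p}) \<ge> 3"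
  proof (cases "card (M u ` B) \<ge> 4")
    case True
    obtain w v where wv: "w \<in> A" "v \<in> B" "M w v \<noteq> M u v" using False by blast
    have "card (M u ` B - {M u v}) \<ge> 3" "card (M u ` B - {M w v}) \<ge> 3"
      using card_minus_singleton_ge[OF True] by simp_all
    then have "\<forall>x\<in>B. M w x = M w v" using const[OF wv] minus[of 3] by fastforce
    with wv(1) \<open>card (M u ` B - {M w v}) \<ge> 3\<close> show ?thesis by blast
  next
    case False
    have "finite (M u ` B)" using three by (metis card.infinite not_numeral_le_zero)
    then have "\<not> case_prod M ` (A \<times> B) \<subseteq> M u ` B"
      using False four card_mono[of "M u ` B" "case_prod M ` (A \<times> B)"] by linarith
    then obtain w v where wv: "w \<in> A" "v \<in> B" "M w v \<notin> M u ` B" by auto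
    then have "card (M u ` B - {M w v}) \<ge> 3" using three by simp
    moreover from this have "card (M u ` B - {M w v, M u v}) \<ge> 2" using minus[of 3] by force
    moreover have "M w v \<noteq> M u v" using wv by auto
    ultimately have "\<forall>x\<in>B. M w x = M w v"
      using const[OF wv(1,2)] by (metis insert_commute)
    with wv(1) \<open>card (M u ` B - {M w v}) \<ge> 3\<close> show ?thesis by blast
  qed
  then obtain w0 p where w0: "w0 \<in> A" "\<And>v. v \<in> B \<Longrightarrow> M w0 v = p"
    and p3: "card (M u ` B - {p}) \<ge> 3" by blast
  have dev: "M w v = p" if "w \<in> A" "v \<in> B" "M w v \<noteq> M u v" "M u v \<noteq> p" for w v
  proof (rule ccontr)
    assume np: "M w v \<noteq> p"
    have "card (M u ` B - {p} - {M u v} - {M w v}) \<ge> 1"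
      using card_minus_singleton_ge[OF card_minus_singleton_ge[OF p3]] by simp
    then have "M u ` B - {p} - {M u v} - {M w v} \<noteq> {}"
      by (metis card.empty not_one_le_zero)
    then obtain v' where "v' \<in> B" "M u v' \<noteq> p" "M u v' \<noteq> M u v" "M u v' \<noteq> M w v" by auto
    then show False
      using R[of w0 v' u v w] that np w0 u by auto
  qed
  have "(\<forall>v\<in>B. M w v = M u v) \<or> (\<forall>v\<in>B. M w v = p)" if w: "w \<in> A" for w
  proof (cases "\<exists>v\<in>B. M w v \<noteq> M u v \<and> M u v \<noteq> p")
    case True
    then obtain v where v: "v \<in> B" "M w v \<noteq> M u v" "M u v \<noteq> p" by blast
    have "M w v = p" using dev w v by blast
    moreover have "card (M u ` B - {M u v, p}) \<ge> 2"
      using minus[OF p3, of "M u v"] by (simp add: insert_commute)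
    ultimately show ?thesis using const[OF w v(1,2)] v(2) by metis
  next
    case False
    show ?thesis
    proof (rule ccontr)
      assume neg: "\<not> ?thesis"
      then obtain v where v: "v \<in> B" "M w v \<noteq> M u v" by blast
      then have uv: "M u v = p" using False by blast
      have c2: "card (M u ` B - {p, M w v}) \<ge> 2" using minus[OF p3] by simp
      then have cw: "\<forall>x\<in>B. M w x = M w v" using const[OF w v] uv by metis
      obtain s where "s \<in> M u ` B - {p, M w v}" using ex_distinct_of_card_ge_2[OF c2] by blast
      then obtain x where "x \<in> B" "M u x \<noteq> p" "M u x \<noteq> M w v" by auto
      then show False using cw False by fastforce
    qed
  qed
  then show ?thesis by blast
qed

text \<open>
  Let \<open>F\<close> be the set of the two colours of some row \<open>u\<close>. Two columns with different colours
  outside \<open>F\<close> meet row \<open>u\<close> in the same colour, since otherwise there is a rainbow path through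
  \<open>u\<close>. As there are at least two colours outside \<open>F\<close>, this colour \<open>x\<close> is the same for all columns
  with a colour outside \<open>F\<close>. A row without \<open>x\<close> would have only colours outside
  \<open>F\<close>, one of them in a column that meets row \<open>u\<close> in its other colour. A column without \<open>x\<close>
  would have two colours outside \<open>F\<close> and, in row \<open>u\<close>, one in \<open>F\<close>.
\<close>

lemma common_colour_of_2_coloured_lines:
  fixes M :: "'a \<Rightarrow> 'b \<Rightarrow> 'c"
  assumes free: "rainbow_P5_free A B M" and finA: "finite A" and B: "card B \<ge> 3"
    and rows: "\<And>a. a \<in> A \<Longrightarrow> card (M a ` B) \<le> 2"
    and cols: "\<And>b. b \<in> B \<Longrightarrow> card ((\<lambda>a. M a b) ` A) \<le> 2"
    and four: "card (case_prod M ` (A \<times> B)) \<ge> 4"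
  shows "\<exists>x. (\<forall>a\<in>A. \<exists>y. \<forall>b\<in>B. M a b \<in> {x, y}) \<and> (\<forall>b\<in>B. \<exists>y. \<forall>a\<in>A. M a b \<in> {x, y})"
proof -
  have finB: "finite B" using B by (metis card.infinite not_numeral_le_zero)
  have row: "M a b'' = M a b \<or> M a b'' = M a b'"
    if "a \<in> A" "b \<in> B" "b' \<in> B" "b'' \<in> B" "M a b \<noteq> M a b'" for a b b' b''
    using third_element_of_card_le_2[OF rows[OF that(1)]] finB that by auto
  have col: "M a'' b = M a b \<or> M a'' b = M a' b"
    if "b \<in> B" "a \<in> A" "a' \<in> A" "a'' \<in> A" "M a b \<noteq> M a' b" for a a' a'' b
    using third_element_of_card_le_2[OF cols[OF that(1)], of "M a b" "M a' b" "M a'' b"] finA that by auto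
  note R1 = no_rainbow_outer_rows[OF free _ _ _ _ _ _ _]
  note R2 = no_rainbow_outer_columns[OF free _ _ _ _ _ _ _]
  have "\<exists>u\<in>A. \<exists>v\<in>B. \<exists>v'\<in>B. M u v \<noteq> M u v'"
  proof (rule ccontr)
    assume "\<not> ?thesis"
    then have const: "M u v = M u v'" if "u \<in> A" "v \<in> B" "v' \<in> B" for u v v' using that by blast
    obtain b where b: "b \<in> B" using B by fastforce
    have "case_prod M ` (A \<times> B) \<subseteq> (\<lambda>a. M a b) ` A" using const[OF _ _ b] by fastforce
    from card_mono[OF finite_imageI[OF finA] this]
    have "card (case_prod M ` (A \<times> B)) \<le> 2" using cols[OF b] by linarith
    then show False using four by simp
  qed
  then obtain u v1 v2 where u: "u \<in> A" "v1 \<in> B" "v2 \<in> B" "M u v1 \<noteq> M u v2" by blast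
  define F where "F = {M u v1, M u v2}"
  have uF: "M u b \<in> F" if "b \<in> B" for b using row[of u v1 v2 b] u that by (auto simp: F_def)
  have same: "M u z = M u z'"
    if wz: "w \<in> A" "z \<in> B" "w' \<in> A" "z' \<in> B" "M w z \<notin> F" "M w' z' \<notin> F" "M w z \<noteq> M w' z'"
    for w z w' z'
  proof (rule ccontr)
    assume ne: "M u z \<noteq> M u z'"
    note uz = uF[OF wz(2)] uF[OF wz(4)]
    have "M w z \<noteq> M u z" "M w z \<noteq> M u z'" "M w' z' \<noteq> M u z" "M w' z' \<noteq> M u z'"
      using wz(5,6) uz by metis+
    then have d: "distinct [M w z, M u z, M u z', M w' z']" using ne wz(7) by simp
    show False
    proof (cases "w = w'")
      case False
      then show False using R1[OF d] wz u by blast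
    next
      case True
      have "card (B - {z} - {z'}) \<ge> 1"
        using card_minus_singleton_ge[OF card_minus_singleton_ge[OF B]] by simp
      then have "B - {z} - {z'} \<noteq> {}" by (metis card.empty not_one_le_zero)
      then obtain x where x: "x \<in> B" "x \<noteq> z" "x \<noteq> z'" by auto
      \<comment> \<open>The edges between \<open>u\<close>, \<open>w\<close> and \<open>z\<close>, \<open>z'\<close> form a rainbow 4-cycle. The edge from \<open>u\<close>
        to \<open>x\<close> has the colour of one of the two cycle edges at \<open>u\<close>; put in its place, it gives a
        rainbow path.\<close>
      have "M u x = M u z \<or> M u x = M u z'" using row ne wz u x by blast
      then show False
        using R2[of u x z w z'] R2[of u x z' w z] d True x wz u by auto
    qed
  qed
  have "card (case_prod M ` (A \<times> B) - {M u v1} - {M u v2}) \<ge> 2"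
    using card_minus_singleton_ge[OF card_minus_singleton_ge[OF four]] by simp
  then obtain s t where "s \<in> case_prod M ` (A \<times> B) - {M u v1} - {M u v2}"
    "t \<in> case_prod M ` (A \<times> B) - {M u v1} - {M u v2}" "s \<noteq> t"
    using ex_distinct_of_card_ge_2 by blast
  then obtain w3 z3 w4 z4 where wz: "w3 \<in> A" "z3 \<in> B" "w4 \<in> A" "z4 \<in> B"
      "M w3 z3 \<notin> F" "M w4 z4 \<notin> F" "M w3 z3 \<noteq> M w4 z4"
    by (auto simp: F_def)
  define x where "x = M u z3"
  have x4: "M u z4 = x" using same[OF wz] by (simp add: x_def)
  have foreign: "M u z = x" if "w \<in> A" "z \<in> B" "M w z \<notin> F" for w z
  proof (cases "M w z = M w3 z3")
    case True
    then show ?thesis using same[of w z w4 z4] that wz x4 by metis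
  next
    case False
    then show ?thesis using same[of w z w3 z3] that wz unfolding x_def by metis
  qed
  obtain v where v: "v \<in> B" "M u v \<noteq> x" using u by metis
  have xF: "x \<in> F" using uF wz by (simp add: x_def)
  have row1: "M a b = M a b'"
    if a: "a \<in> A" and b: "b \<in> B" "b' \<in> B" and nx: "M a b \<noteq> x" "M a b' \<noteq> x" for a b b'
  proof (rule ccontr)
    assume ne: "M a b \<noteq> M a b'"
    have "x \<notin> M a ` B" using row[OF a b _ ne] nx by force
    then have "M a z3 \<noteq> x" "M a z4 \<noteq> x" using a wz by blast+
    then have "M a z3 = M w3 z3" "M a z4 = M w4 z4"
      using col[of z3 u w3 a] col[of z4 u w4 a] u a wz x4 xF unfolding x_def by metis+
    then have "M a v \<notin> F" using row[of a z3 z4 v] a v wz by metis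
    then show False using foreign a v by blast
  qed
  have col1: "M a b = M a' b"
    if b: "b \<in> B" and a: "a \<in> A" "a' \<in> A" and nx: "M a b \<noteq> x" "M a' b \<noteq> x" for a a' b
  proof (rule ccontr)
    assume ne: "M a b \<noteq> M a' b"
    have nc: "M c b \<noteq> x" if "c \<in> A" for c using col[OF b a that ne] nx by metis
    have "M w3 b = M w3 z3" "M w4 b = M w4 z4" "M u b \<in> F"
      using row1 nc b wz xF uF by metis+
    then show False using col[of b w3 w4 u] b wz u by metis
  qed
  have "\<exists>y. \<forall>b\<in>B. M a b \<in> {x, y}" if "a \<in> A" for a
    using row1[OF that] by (cases "\<exists>b\<in>B. M a b \<noteq> x") blast+
  moreover have "\<exists>y. \<forall>a\<in>A. M a b \<in> {x, y}" if "b \<in> B" for b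
    using col1[OF that] by (cases "\<exists>a\<in>A. M a b \<noteq> x") blast+
  ultimately show ?thesis by blast
qed

section \<open>Copies of graphs given by embeddings\<close>

lemma image_is_copy:
  assumes H: "simple_graph H" and inj: "inj_on f (verts H)" and V: "f ` verts H \<subseteq> verts G"
    and E: "\<And>e. e \<in> edges H \<Longrightarrow> f ` e \<in> edges G"
  shows "is_copy \<lparr>verts = f ` verts H, edges = (\<lambda>e. f ` e) ` edges H\<rparr> H G"
proof -
  have sub: "e \<subseteq> verts H" "card e = 2" if "e \<in> edges H" for e
    using H that by (auto simp: simple_graph_def)
  let ?S = "\<lparr>verts = f ` verts H, edges = (\<lambda>e. f ` e) ` edges H\<rparr>"
  have "card (f ` e) = 2" if "e \<in> edges H" for e
    using sub[OF that] inj by (metis card_image inj_on_subset)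
  moreover have "finite (verts H)" using H by (simp add: simple_graph_def)
  ultimately have "simple_graph ?S" using sub(1) by (auto simp: simple_graph_def)
  then have "subgraph_of ?S G" using V E by (auto simp: subgraph_of_def)
  moreover have "isomorphic ?S H"
    unfolding isomorphic_def
  proof (intro exI conjI)
    let ?g = "inv_into (verts H) f"
    have "?g ` f ` e = e" if "e \<in> edges H" for e
      using inv_into_image_cancel[OF inj sub(1)[OF that]] .
    then show "(\<lambda>e. ?g ` e) ` edges ?S = edges H" by (simp add: image_image)
    show "bij_betw ?g (verts ?S) (verts H)"
      using inj by (simp add: bij_betw_inv_into inj_on_imp_bij_betw)
  qed
  ultimately show ?thesis unfolding is_copy_def ..
qed

lemma monochromatic_copyI:
  assumes H: "simple_graph H" and inj: "inj_on f (verts H)" and V: "f ` verts H \<subseteq> verts G"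
    and E: "\<And>e. e \<in> edges H \<Longrightarrow> f ` e \<in> edges G \<and> c (f ` e) = x"
  shows "\<exists>S. is_copy S H G \<and> monochromatic c S"
proof -
  have "is_copy \<lparr>verts = f ` verts H, edges = (\<lambda>e. f ` e) ` edges H\<rparr> H G"
    using image_is_copy[OF H inj V] E by blast
  moreover have "monochromatic c \<lparr>verts = f ` verts H, edges = (\<lambda>e. f ` e) ` edges H\<rparr>"
    using E by (auto simp: monochromatic_def)
  ultimately show ?thesis by blast
qed

lemma copy_embedding:
  assumes "is_copy S H G"
  obtains f where "inj_on f (verts H)" "f ` verts H \<subseteq> verts G" "edges S = (\<lambda>e. f ` e) ` edges H"
    "edges S \<subseteq> edges G"
proof -
  obtain g where g: "bij_betw g (verts S) (verts H)" "(\<lambda>e. g ` e) ` edges S = edges H"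
    and S: "simple_graph S" "verts S \<subseteq> verts G" "edges S \<subseteq> edges G"
    using assms unfolding is_copy_def isomorphic_def subgraph_of_def by blast
  let ?f = "inv_into (verts S) g"
  have "bij_betw ?f (verts H) (verts S)" using g(1) by (rule bij_betw_inv_into)
  then have "inj_on ?f (verts H)" "?f ` verts H \<subseteq> verts G"
    using S by (auto simp: bij_betw_def)
  moreover have "inv_into (verts S) g ` g ` e = e" if "e \<in> edges S" for e
    using that S g(1) by (intro inv_into_image_cancel) (auto simp: simple_graph_def bij_betw_def)
  then have "edges S = (\<lambda>e. ?f ` e) ` edges H"
    using g(2)[symmetric] by (force simp: image_image)
  ultimately show thesis using that S(3) by blast
qed

lemma edges_copies_of_path:
  "edges (disjoint_copies r (path_graph l)) = {{(i, j), (i, Suc j)} | i j. i < r \<and> Suc j < l}"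
proof -
  have pair: "Pair i ` {j, Suc j} = {(i, j), (i, Suc j)}" for i j by simp
  have "edges (disjoint_copies r (path_graph l)) =
      {Pair i ` {j, Suc j} | i j. i < r \<and> Suc j < l}"
    unfolding disjoint_copies_def path_graph_def ugraph.simps by blast
  then show ?thesis unfolding pair .
qed

lemma verts_copies_of_path:
  "verts (disjoint_copies r (path_graph l)) = {..<r} \<times> {..<l}"
  by (simp add: disjoint_copies_def path_graph_def)

lemma simple_copies_of_path: "simple_graph (disjoint_copies r (path_graph l))"
  by (simp add: simple_graph_disjoint_copies simple_graph_path_graph)

lemma block_index_less:
  fixes i j r l :: nat
  assumes "i < r" "j < l" shows "i * l + j < r * l"
proof -
  have "i * l + j < Suc i * l" using assms by simp
  also have "\<dots> \<le> r * l" using assms by (intro mult_right_mono) auto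
  finally show ?thesis .
qed

lemma block_index_eq:
  fixes i i' j j' l :: nat
  assumes "i * l + j = i' * l + j'" "j < l" "j' < l" shows "i = i' \<and> j = j'"
proof -
  have "(a * l + b) div l = a" if "b < l" for a b using that by simp
  then have "i = i'" using assms by metis
  then show ?thesis using assms(1) by simp
qed

text \<open>
  The path is cut into \<open>r\<close> consecutive pieces on \<open>l\<close> vertices.
\<close>

lemma copies_in_long_path:
  assumes P: "distinct P" "set P \<subseteq> verts G" "r * l \<le> length P"
    and E: "\<And>i. Suc i < length P \<Longrightarrow> {P ! i, P ! Suc i} \<in> edges G \<and> c {P ! i, P ! Suc i} = x"
  shows "\<exists>S. is_copy S (disjoint_copies r (path_graph l)) G \<and> monochromatic c S"
proof (rule monochromatic_copyI[where f = "\<lambda>(i, j). P ! (i * l + j)" and x = x])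
  show "simple_graph (disjoint_copies r (path_graph l))" by (rule simple_copies_of_path)
  have less: "i * l + j < length P" if "i < r" "j < l" for i j
    using block_index_less[OF that] P(3) by simp
  show "inj_on (\<lambda>(i, j). P ! (i * l + j)) (verts (disjoint_copies r (path_graph l)))"
  proof (rule inj_onI, clarsimp simp: verts_copies_of_path)
    fix i j i' j'
    assume ij: "i < r" "j < l" "i' < r" "j' < l" and "P ! (i * l + j) = P ! (i' * l + j')"
    then have "i * l + j = i' * l + j'" using less nth_eq_iff_index_eq[OF P(1)] by blast
    then show "i = i' \<and> j = j'" using block_index_eq ij by blast
  qed
  show "(\<lambda>(i, j). P ! (i * l + j)) ` verts (disjoint_copies r (path_graph l)) \<subseteq> verts G"
    using less by (auto simp: verts_copies_of_path intro!: subsetD[OF P(2)] nth_mem)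
  fix e assume "e \<in> edges (disjoint_copies r (path_graph l))"
  then obtain i j where e: "e = {(i, j), (i, Suc j)}" "i < r" "Suc j < l"
    by (auto simp: edges_copies_of_path)
  show "(\<lambda>(i, j). P ! (i * l + j)) ` e \<in> edges G \<and> c ((\<lambda>(i, j). P ! (i * l + j)) ` e) = x"
    using E[of "i * l + j"] less[of i "Suc j", OF e(2,3)] by (simp add: e(1))
qed

text \<open>
  Every copy of the path alternates between its own block of \<open>X\<close>, which it starts in, and its own
  block of \<open>Y\<close>. For odd \<open>l\<close> it uses one vertex more in \<open>X\<close> than in \<open>Y\<close>.
\<close>

lemma copies_in_biclique:
  assumes X: "finite X" "X \<subseteq> verts G" "r * ((l + 1) div 2) \<le> card X"
    and Y: "finite Y" "Y \<subseteq> verts G" "r * (l div 2) \<le> card Y"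
    and disj: "X \<inter> Y = {}"
    and E: "\<And>v w. v \<in> X \<Longrightarrow> w \<in> Y \<Longrightarrow> {v, w} \<in> edges G \<and> c {v, w} = x"
  shows "\<exists>S. is_copy S (disjoint_copies r (path_graph l)) G \<and> monochromatic c S"
proof -
  let ?h = "(l + 1) div 2" and ?m = "l div 2"
  obtain a where a: "bij_betw a {0..<card X} X" using ex_bij_betw_nat_finite[OF X(1)] by blast
  obtain b where b: "bij_betw b {0..<card Y} Y" using ex_bij_betw_nat_finite[OF Y(1)] by blast
  define f where
    "f = (\<lambda>(i, j). if even j then a (i * ?h + j div 2) else b (i * ?m + j div 2))"
  have even: "i * ?h + j div 2 < card X" "j div 2 < ?h" if "i < r" "j < l" "even j" for i j
  proof -
    show "j div 2 < ?h" using that by presburger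
    then show "i * ?h + j div 2 < card X" using block_index_less[of i r "j div 2" ?h] that X by simp
  qed
  have odd: "i * ?m + j div 2 < card Y" "j div 2 < ?m" if "i < r" "j < l" "odd j" for i j
  proof -
    show "j div 2 < ?m" using that by presburger
    then show "i * ?m + j div 2 < card Y" using block_index_less[of i r "j div 2" ?m] that Y by simp
  qed
  have fX: "f (i, j) \<in> X" if "i < r" "j < l" "even j" for i j
    using even[OF that] that a by (auto simp: f_def bij_betw_def)
  have fY: "f (i, j) \<in> Y" if "i < r" "j < l" "odd j" for i j
    using odd[OF that] that b by (auto simp: f_def bij_betw_def)
  have inj: "i = i' \<and> j = j'"
    if ij: "i < r" "j < l" "i' < r" "j' < l" and eq: "f (i, j) = f (i', j')" for i j i' j'
  proof (cases "even j")
    case True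
    then have j': "even j'" using fX[OF ij(1,2)] fY[OF ij(3,4)] eq disj by auto
    have "i * ?h + j div 2 = i' * ?h + j' div 2"
      using eq True j' even ij bij_betw_imp_inj_on[OF a] by (auto simp: f_def inj_on_def)
    then have "i = i' \<and> j div 2 = j' div 2" using block_index_eq even ij True j' by blast
    then show ?thesis using True j' by (metis even_two_times_div_two)
  next
    case False
    then have j': "odd j'" using fY[OF ij(1,2)] fX[OF ij(3,4)] eq disj by auto
    have "i * ?m + j div 2 = i' * ?m + j' div 2"
      using eq False j' odd ij bij_betw_imp_inj_on[OF b] by (auto simp: f_def inj_on_def)
    then have "i = i' \<and> j div 2 = j' div 2" using block_index_eq odd ij False j' by blast
    then show ?thesis using False j' by (metis odd_two_times_div_two_succ)
  qed
  show ?thesis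
  proof (rule monochromatic_copyI[where f = f and x = x])
    show "simple_graph (disjoint_copies r (path_graph l))" by (rule simple_copies_of_path)
    show "inj_on f (verts (disjoint_copies r (path_graph l)))"
      using inj by (auto simp: inj_on_def verts_copies_of_path)
    show "f ` verts (disjoint_copies r (path_graph l)) \<subseteq> verts G"
      using fX fY X(2) Y(2) unfolding verts_copies_of_path by blast
    fix e assume "e \<in> edges (disjoint_copies r (path_graph l))"
    then obtain i j where e: "e = {(i, j), (i, Suc j)}" "i < r" "Suc j < l"
      by (auto simp: edges_copies_of_path)
    then show "f ` e \<in> edges G \<and> c (f ` e) = x"
      using E[of "f (i, j)" "f (i, Suc j)"] E[of "f (i, Suc j)" "f (i, j)"]
        fX[of i j] fY[of i "Suc j"] fX[of i "Suc j"] fY[of i j]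
      by (cases "even j") (simp_all add: insert_commute)
  qed
qed

lemma edges_path_5: "edges (path_graph 5) = {{0, 1}, {1, 2}, {2, 3}, {3, 4}}"
proof -
  have "edges (path_graph 5) = (\<lambda>i. {i, Suc i}) ` {..<4}"
    by (auto simp: path_graph_def)
  also have "{..<4 :: nat} = {0, 1, 2, 3}" by auto
  finally show ?thesis by (simp add: numeral_eq_Suc)
qed

lemma rainbow_copyI:
  assumes v: "distinct [v0, v1, v2, v3, v4]" "{v0, v1, v2, v3, v4} \<subseteq> verts G"
    and E: "{{v0, v1}, {v1, v2}, {v2, v3}, {v3, v4}} \<subseteq> edges G"
    and c: "distinct [c {v0, v1}, c {v1, v2}, c {v2, v3}, c {v3, v4}]"
  shows "\<exists>S. is_copy S (path_graph 5) G \<and> rainbow c S"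
proof -
  define f where "f = (!) [v0, v1, v2, v3, v4]"
  have f: "f 0 = v0" "f 1 = v1" "f 2 = v2" "f 3 = v3" "f 4 = v4" by (simp_all add: f_def)
  have V: "verts (path_graph 5) = {0, 1, 2, 3, 4}" by (auto simp: path_graph_def)
  define S where "S = \<lparr>verts = f ` verts (path_graph 5), edges = (\<lambda>e. f ` e) ` edges (path_graph 5)\<rparr>"
  have ES: "edges S = {{v0, v1}, {v1, v2}, {v2, v3}, {v3, v4}}"
    unfolding S_def ugraph.simps edges_path_5 image_insert image_empty f ..
  have "is_copy S (path_graph 5) G"
    unfolding S_def
  proof (rule image_is_copy[OF simple_graph_path_graph])
    show "inj_on f (verts (path_graph 5))"
      unfolding V inj_on_def using v(1) f by auto
    show "f ` verts (path_graph 5) \<subseteq> verts G"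
      unfolding V image_insert image_empty f using v(2) by blast
    show "f ` e \<in> edges G" if "e \<in> edges (path_graph 5)" for e
    proof -
      have "f ` e \<in> edges S" using that by (simp add: S_def)
      then show ?thesis using E unfolding ES by (rule subsetD[rotated])
    qed
  qed
  moreover have "inj_on c (set [{v0, v1}, {v1, v2}, {v2, v3}, {v3, v4}])"
    using c distinct_map[of c "[{v0, v1}, {v1, v2}, {v2, v3}, {v3, v4}]"] unfolding list.map by blast
  then have "rainbow c S" unfolding rainbow_def ES list.set .
  ultimately show ?thesis by blast
qed

section \<open>Depth-first search and alternating paths\<close>

text \<open>
  This is the invariant of a depth-first search: \<open>T\<close> is the set of vertices not yet visited, \<open>P\<close> is
  the stack, and \<open>S\<close> is the set of vertices already abandoned. Each step moves one vertex from \<open>T\<close>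
  to \<open>P\<close> or from \<open>P\<close> to \<open>S\<close>, and so lowers \<open>card T - card S\<close> by one. This difference starts at \<open>card V\<close>
  and is zero at some moment.
\<close>

lemma path_with_separated_remainder:
  fixes E :: "'v \<Rightarrow> 'v \<Rightarrow> bool"
  assumes fin: "finite V"
  obtains S P T where "S \<union> set P \<union> T = V" "S \<inter> set P = {}" "S \<inter> T = {}" "set P \<inter> T = {}"
    "distinct P" "successively E P" "card S = card T" "\<And>s t. s \<in> S \<Longrightarrow> t \<in> T \<Longrightarrow> \<not> E t s"
proof -
  define good where "good = (\<lambda>(S, P, T). S \<union> set P \<union> T = V \<and> S \<inter> set P = {} \<and> S \<inter> T = {} \<and>
     set P \<inter> T = {} \<and> distinct P \<and> successively E P \<and> card S \<le> card T \<and>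
     (\<forall>s\<in>S. \<forall>t\<in>T. \<not> E t s))"
  \<comment> \<open>This measure decreases when a vertex moves from \<open>T\<close> to \<open>P\<close> or from \<open>P\<close> to \<open>S\<close>.\<close>
  define \<mu> where "\<mu> = (\<lambda>(S :: 'v set, P :: 'v list, T :: 'v set). 2 * card T + length P)"
  have "good ({}, [], V)" by (simp add: good_def)
  then obtain z where z: "good z" and min: "\<And>y. good y \<Longrightarrow> \<mu> z \<le> \<mu> y"
    using ex_has_least_nat[of good "({}, [], V)" \<mu>] by blast
  obtain S P T where zeq: "z = (S, P, T)" by (cases z)
  have g: "S \<union> set P \<union> T = V" "S \<inter> set P = {}" "S \<inter> T = {}" "set P \<inter> T = {}" "distinct P"
    "successively E P" "card S \<le> card T" "\<And>s t. s \<in> S \<Longrightarrow> t \<in> T \<Longrightarrow> \<not> E t s"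
    using z by (auto simp: zeq good_def)
  have finS: "finite S" and finT: "finite T" using g(1) fin by auto
  have "card S = card T"
  proof (rule ccontr)
    assume "card S \<noteq> card T"
    then have less: "card S < card T" using g(7) by simp
    have push: False if "t \<in> T" "P = [] \<or> E t (hd P)" for t
    proof -
      have "card (T - {t}) = card T - 1" "card T > 0" using finT that by (auto simp: card_gt_0_iff)
      then have "good (S, t # P, T - {t})" "\<mu> (S, t # P, T - {t}) < \<mu> z"
        using g less that by (auto simp: good_def \<mu>_def zeq successively_Cons)
      then show False using min by fastforce
    qed
    show False
    proof (cases P)
      case Nil
      have "T \<noteq> {}" using less by auto
      then show False using push Nil by blast
    next
      case (Cons v Q)
      then have no: "\<not> E t v" if "t \<in> T" for t using push that by auto
      have "card (insert v S) = Suc (card S)" using g(2) Cons finS by simp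
      then have "good (insert v S, Q, T)" "\<mu> (insert v S, Q, T) < \<mu> z"
        using g less no Cons by (auto simp: good_def \<mu>_def zeq successively_Cons)
      then show False using min by fastforce
    qed
  qed
  then show thesis using that[OF g(1-6)] g(8) by blast
qed

text \<open>
  The sharper statement proved by induction fixes which side has the surplus: the side
  of the first vertex.
\<close>

lemma alternating_path_counts:
  assumes "distinct P" "successively (\<lambda>v w. v \<in> X \<longleftrightarrow> w \<notin> X) P"
  shows "card (set P - X) \<le> card (set P \<inter> X) + 1" "card (set P \<inter> X) \<le> card (set P - X) + 1"
proof -
  have "P = [] \<or> (if hd P \<in> X
      then card (set P \<inter> X) \<in> {card (set P - X), card (set P - X) + 1}
      else card (set P - X) \<in> {card (set P \<inter> X), card (set P \<inter> X) + 1})"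
    using assms
  proof (induction P)
    case (Cons v P)
    have "card (set (v # P) \<inter> X) = (if v \<in> X then Suc (card (set P \<inter> X)) else card (set P \<inter> X))"
      "card (set (v # P) - X) = (if v \<in> X then card (set P - X) else Suc (card (set P - X)))"
      using Cons.prems(1) by (auto simp: insert_Diff_if)
    moreover have "P = [] \<or> (v \<in> X \<longleftrightarrow> hd P \<notin> X)"
      using Cons.prems(2) by (auto simp: successively_Cons)
    moreover have "P = [] \<or> (if hd P \<in> X
      then card (set P \<inter> X) \<in> {card (set P - X), card (set P - X) + 1}
      else card (set P - X) \<in> {card (set P \<inter> X), card (set P \<inter> X) + 1})"
      using Cons.IH Cons.prems by (auto simp: successively_Cons)
    ultimately show ?case
      by (cases "v \<in> X"; cases "P = []") (auto simp del: list.set(2))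
  qed simp
  then show "card (set P - X) \<le> card (set P \<inter> X) + 1" "card (set P \<inter> X) \<le> card (set P - X) + 1"
    by (auto split: if_splits)
qed

section \<open>Monochromatic copies in large complete bipartite graphs\<close>

text \<open>
  The situation of the upper bound, with a pair of sides that can be exchanged: what holds for the
  vertices in \<open>A\<close> then holds for those in \<open>B\<close>.
\<close>

locale coloured_biclique =
  fixes G :: "'v ugraph" and c :: "'v set \<Rightarrow> nat" and A B :: "'v set" and N k l r :: nat
  assumes sides: "A \<inter> B = {}" "A \<union> B \<subseteq> verts G" "finite A" "finite B" "card A = N" "card B = N"
    and edge: "\<And>a b. a \<in> A \<Longrightarrow> b \<in> B \<Longrightarrow> {a, b} \<in> edges G"
    and colours: "(\<lambda>(a, b). c {a, b}) ` (A \<times> B) = {1..k}"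
    and no_rainbow: "\<not> (\<exists>S. is_copy S (path_graph 5) G \<and> rainbow c S)"
    and params: "k \<ge> 4" "l \<ge> 10" "r \<ge> 1"
    and large: "N > k * (r * (l div 2) - 1)"
begin

lemma sides_swapped: "coloured_biclique G c B A N k l r"
proof
  have "(\<lambda>(a, b). c {a, b}) ` (B \<times> A) = (\<lambda>(a, b). c {b, a}) ` prod.swap ` (B \<times> A)"
    by (simp add: image_image case_prod_beta)
  also have "\<dots> = (\<lambda>(a, b). c {a, b}) ` (A \<times> B)"
    by (simp add: insert_commute product_swap)
  finally have "(\<lambda>(a, b). c {a, b}) ` (B \<times> A) = (\<lambda>(a, b). c {a, b}) ` (A \<times> B)" .
  then show "(\<lambda>(a, b). c {a, b}) ` (B \<times> A) = {1..k}" using colours by simp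
  show "{a, b} \<in> edges G" if "a \<in> B" "b \<in> A" for a b
    using edge[OF that(2,1)] by (simp add: insert_commute)
qed (use sides no_rainbow params large in auto)

lemma edge_rev: "a \<in> A \<Longrightarrow> b \<in> B \<Longrightarrow> {b, a} \<in> edges G"
  using edge[of a b] by (simp add: insert_commute)

text \<open>
  All later comparisons of sizes follow from these relations by linear arithmetic, with the products
  treated as atoms.
\<close>

lemma size_bounds:
  "5 * r \<le> r * (l div 2)" "r * ((l + 1) div 2) \<le> r * (l div 2) + r"
  "r * l = r * (l div 2) + r * ((l + 1) div 2)" "r * (l div 2) \<le> r * ((l + 1) div 2)"
  "4 * (r * (l div 2)) \<le> N + 3"
proof -
  have "r * 5 \<le> r * (l div 2)" using params(2) by (intro mult_le_mono) auto
  then show "5 * r \<le> r * (l div 2)" by simp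
  have "r * ((l + 1) div 2) \<le> r * (l div 2 + 1)" by (intro mult_le_mono) auto
  then show "r * ((l + 1) div 2) \<le> r * (l div 2) + r" by simp
  have "l = l div 2 + (l + 1) div 2" by presburger
  then show "r * l = r * (l div 2) + r * ((l + 1) div 2)" by (metis distrib_left)
  show "r * (l div 2) \<le> r * ((l + 1) div 2)" by (intro mult_le_mono) auto
  have "4 * (r * (l div 2) - 1) \<le> k * (r * (l div 2) - 1)" using params(1) by (intro mult_le_mono) auto
  then show "4 * (r * (l div 2)) \<le> N + 3" using large by linarith
qed

lemma rainbow_free: "rainbow_P5_free A B (\<lambda>a b. c {a, b})"
proof -
  have half: "rainbow_P5_free_from X Y (\<lambda>a b. c {a, b})"
    if XY: "X \<inter> Y = {}" "X \<union> Y \<subseteq> verts G" "\<And>a b. a \<in> X \<Longrightarrow> b \<in> Y \<Longrightarrow> {a, b} \<in> edges G" for X Y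
    unfolding rainbow_P5_free_from_def
  proof (intro ballI impI notI)
    fix a b a' b' a''
    assume in': "a \<in> X" "b \<in> Y" "a' \<in> X" "b' \<in> Y" "a'' \<in> X" and d: "distinct [a, a', a'']" "b \<noteq> b'"
      and col: "distinct [c {a, b}, c {a', b}, c {a', b'}, c {a'', b'}]"
    have "\<exists>S. is_copy S (path_graph 5) G \<and> rainbow c S"
    proof (rule rainbow_copyI[of a b a' b' a''])
      show "distinct [a, b, a', b', a'']" using in' d XY(1) by auto
      show "{a, b, a', b', a''} \<subseteq> verts G" using in' XY(2) by blast
      show "{{a, b}, {b, a'}, {a', b'}, {b', a''}} \<subseteq> edges G"
        using in' XY(3) by (simp add: insert_commute)
      show "distinct [c {a, b}, c {b, a'}, c {a', b'}, c {b', a''}]"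
        using col by (simp add: insert_commute)
    qed
    then show False using no_rainbow by blast
  qed
  have "rainbow_P5_free_from B A (\<lambda>b a. c {b, a})"
  proof (rule half)
    show "{b, a} \<in> edges G" if "b \<in> B" "a \<in> A" for a b
      using edge[OF that(2,1)] by (simp add: insert_commute)
  qed (use sides in auto)
  then have "rainbow_P5_free_from B A (\<lambda>b a. c {a, b})"
    by (simp add: insert_commute)
  moreover have "rainbow_P5_free_from A B (\<lambda>a b. c {a, b})"
    using sides edge by (intro half) auto
  ultimately show ?thesis unfolding rainbow_P5_free_def by blast
qed

lemma four_colours: "card (case_prod (\<lambda>a b. c {a, b}) ` (A \<times> B)) \<ge> 4"
  using colours params(1) by simp

text \<open>
  Let \<open>U\<close> be the set of vertices whose edges are coloured like those of \<open>u\<close>. If \<open>U\<close> is large, then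
  the colour classes at \<open>u\<close> partition \<open>B\<close> into at most \<open>k\<close> parts, and \<open>U\<close> together with the
  largest part spans a monochromatic complete bipartite graph; this is where the exact bound on \<open>N\<close>
  is used. If \<open>U\<close> is small, then its complement and \<open>B\<close> do so.
\<close>

lemma copies_if_3_coloured_vertex:
  assumes u: "u \<in> A" and three: "card ((\<lambda>b. c {u, b}) ` B) \<ge> 3"
  shows "\<exists>S. is_copy S (disjoint_copies r (path_graph l)) G \<and> monochromatic c S"
proof -
  let ?m = "l div 2" and ?h = "(l + 1) div 2"
  have "card B \<ge> 5" using size_bounds(1,5) params(3) sides(6) by linarith
  then obtain p where p: "\<And>w. w \<in> A \<Longrightarrow> (\<forall>v\<in>B. c {w, v} = c {u, v}) \<or> (\<forall>v\<in>B. c {w, v} = p)"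
    using rows_conform_or_constant[OF rainbow_free _ u three four_colours] by blast
  define U where "U = {w \<in> A. \<forall>v\<in>B. c {w, v} = c {u, v}}"
  have card: "card U + card (A - U) = N"
    using card_Int_Diff[OF sides(3), of U] sides(5) by (simp add: U_def Int_absorb1 subset_eq)
  show ?thesis
  proof (cases "r * ?h \<le> card U")
    case True
    define V where "V = (\<lambda>j. {b \<in> B. c {u, b} = j})"
    have "B = (\<Union>j\<in>{1..k}. V j)" using u colours by (force simp: V_def)
    then have "N \<le> (\<Sum>j\<in>{1..k}. card (V j))"
      using card_UN_le[of "{1..k}" V] sides(6) by simp
    have "\<exists>j. r * ?m \<le> card (V j)"
    proof (rule ccontr)
      assume "\<not> ?thesis"
      then have "card (V j) < r * ?m" for j by (simp add: not_le)
      then have "card (V j) \<le> r * ?m - 1" for j by (metis Suc_pred' gr_zeroI less_Suc_eq_le not_less_zero)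
      then have "(\<Sum>j\<in>{1..k}. card (V j)) \<le> k * (r * ?m - 1)"
        using sum_bounded_above[of "{1..k}" "\<lambda>j. card (V j)" "r * ?m - 1"] by simp
      then show False using \<open>N \<le> _\<close> large by linarith
    qed
    then obtain j where j: "r * ?m \<le> card (V j)" ..
    show ?thesis
    proof (rule copies_in_biclique[of U _ _ _ "V j"])
      show "{v, w} \<in> edges G \<and> c {v, w} = j" if "v \<in> U" "w \<in> V j" for v w
        using that edge by (auto simp: U_def V_def)
    qed (use True j sides in \<open>auto simp: U_def V_def\<close>)
  next
    case False
    show ?thesis
    proof (rule copies_in_biclique[of "A - U" _ _ _ B])
      show "{v, w} \<in> edges G \<and> c {v, w} = p" if "v \<in> A - U" "w \<in> B" for v w
        using that edge p[of v] by (auto simp: U_def)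
      show "r * ?h \<le> card (A - U)" using False card size_bounds params(3) by linarith
      show "r * ?m \<le> card B" using size_bounds sides(6) params(3) by linarith
    qed (use sides in auto)
  qed
qed

text \<open>
  Two consecutive edges that avoid \<open>x\<close> have the same colour, so a long path of such edges is
  monochromatic. If the search finds no long path, then counting on both sides shows that the path
  has equally many vertices on both sides and that \<open>S\<close> and \<open>T\<close> have parts of equal size on opposite
  sides. One of the two pairs of parts is large, and all its edges have colour \<open>x\<close>.
\<close>

lemma copies_if_common_colour:
  assumes rows: "\<And>a. a \<in> A \<Longrightarrow> \<exists>y. \<forall>b\<in>B. c {a, b} \<in> {x, y}"
    and cols: "\<And>b. b \<in> B \<Longrightarrow> \<exists>y. \<forall>a\<in>A. c {a, b} \<in> {x, y}"
  shows "\<exists>S. is_copy S (disjoint_copies r (path_graph l)) G \<and> monochromatic c S"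
proof -
  let ?m = "l div 2" and ?h = "(l + 1) div 2"
  define E where "E v w \<longleftrightarrow> (v \<in> A \<and> w \<in> B \<or> v \<in> B \<and> w \<in> A) \<and> c {v, w} \<noteq> x" for v w
  obtain S P T where part: "S \<union> set P \<union> T = A \<union> B" "S \<inter> set P = {}" "S \<inter> T = {}" "set P \<inter> T = {}"
    and P: "distinct P" "successively E P" and ST: "card S = card T"
    and sep: "\<And>s t. s \<in> S \<Longrightarrow> t \<in> T \<Longrightarrow> \<not> E t s"
    using path_with_separated_remainder[OF finite_UnI[OF sides(3,4)], of E] by metis
  show ?thesis
  proof (cases "r * l \<le> length P")
    case True
    have turn: "c {v, w} = c {w, z}" if vw: "E v w" and wz: "E w z" for v w z
    proof -
      have "\<exists>y. c {v, w} \<in> {x, y} \<and> c {w, z} \<in> {x, y}"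
      proof (cases "w \<in> A")
        case True
        then have "v \<in> B" "z \<in> B" using that sides(1) by (auto simp: E_def)
        then show ?thesis using rows[OF True] by (metis insert_commute)
      next
        case False
        then have "v \<in> A" "z \<in> A" "w \<in> B" using that by (auto simp: E_def)
        then show ?thesis using cols[of w] by (metis insert_commute)
      qed
      moreover have "c {v, w} \<noteq> x" "c {w, z} \<noteq> x" using that by (simp_all add: E_def)
      ultimately show ?thesis by auto
    qed
    have step: "E (P ! i) (P ! Suc i)" if "Suc i < length P" for i
      using P(2) that by (simp add: successively_conv_nth)
    have mono: "c {P ! i, P ! Suc i} = c {P ! 0, P ! 1}" if "Suc i < length P" for i
      using that
    proof (induction i)
      case (Suc i)
      then show ?case using turn[OF step[of i] step[of "Suc i"]] by simp
    qed simp
    show ?thesis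
    proof (rule copies_in_long_path[OF P(1) _ True])
      show "set P \<subseteq> verts G" using part(1) sides(2) by blast
      show "{P ! i, P ! Suc i} \<in> edges G \<and> c {P ! i, P ! Suc i} = c {P ! 0, P ! 1}"
        if "Suc i < length P" for i
        using step[OF that] mono[OF that] edge edge_rev by (auto simp: E_def)
    qed
  next
    case False
    have fin: "finite S" "finite T" 
      using part(1) finite_UnI[OF sides(3,4)] by (metis finite_Un)+
    have cA: "card (S \<inter> A) + card (set P \<inter> A) + card (T \<inter> A) = N"
    proof -
      have "A = (S \<inter> A) \<union> (set P \<inter> A) \<union> (T \<inter> A)" using part(1) by blast
      moreover have "card ((S \<inter> A) \<union> (set P \<inter> A) \<union> (T \<inter> A)) =
          card (S \<inter> A) + card (set P \<inter> A) + card (T \<inter> A)"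
        using fin part by (subst card_Un_disjoint; (subst card_Un_disjoint)?) auto
      ultimately show ?thesis using sides(5) by simp
    qed
    have cB: "card (S \<inter> B) + card (set P - A) + card (T \<inter> B) = N"
    proof -
      have "B = (S \<inter> B) \<union> (set P - A) \<union> (T \<inter> B)" using part(1) sides(1) by blast
      moreover have "card ((S \<inter> B) \<union> (set P - A) \<union> (T \<inter> B)) =
          card (S \<inter> B) + card (set P - A) + card (T \<inter> B)"
        using fin part by (subst card_Un_disjoint; (subst card_Un_disjoint)?) auto
      ultimately show ?thesis using sides(6) by simp
    qed
    have split: "card Z = card (Z \<inter> A) + card (Z \<inter> B)" if "Z \<subseteq> A \<union> B" "finite Z" for Z
      using that sides(1) by (subst card_Un_disjoint[symmetric]) (auto intro: arg_cong[where f = card])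
    have cST: "card (S \<inter> A) + card (S \<inter> B) = card (T \<inter> A) + card (T \<inter> B)"
    proof -
      have "S \<subseteq> A \<union> B" "T \<subseteq> A \<union> B" using part(1) by blast+
      then show ?thesis using split[of S] split[of T] fin ST by simp
    qed
    have cP: "card (set P \<inter> A) + card (set P - A) = length P"
      using distinct_card[OF P(1)] card_Int_Diff[of "set P" A] by simp
    have "successively (\<lambda>v w. v \<in> A \<longleftrightarrow> w \<notin> A) P"
      using P(2) by (rule successively_mono) (use sides(1) in \<open>auto simp: E_def\<close>)
    note alt = alternating_path_counts[OF P(1) this]
    \<comment> \<open>The difference of the two path counts is twice the difference of \<open>card (T \<inter> B)\<close> and
      \<open>card (S \<inter> A)\<close>, and at most one in absolute value, hence zero.\<close>
    have balance: "card (S \<inter> A) = card (T \<inter> B)" "card (T \<inter> A) = card (S \<inter> B)"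
      using cA cB cST alt by presburger+
    have opp: "{v, w} \<in> edges G \<and> c {v, w} = x"
      if "v \<in> A" "w \<in> B" "v \<in> S \<and> w \<in> T \<or> v \<in> T \<and> w \<in> S" for v w
      using that sep[of v w] sep[of w v] edge[of v w] by (auto simp: E_def insert_commute)
    show ?thesis
    proof (cases "r * ?h \<le> card (S \<inter> A)")
      case True
      show ?thesis
      proof (rule copies_in_biclique[of "S \<inter> A" _ _ _ "T \<inter> B"])
        show "r * ?m \<le> card (T \<inter> B)" using True balance size_bounds by linarith
      qed (use True fin sides opp in auto)
    next
      case F: False
      have "r * ?h \<le> card (T \<inter> A)"
        using F False balance cA cB cP size_bounds params(3) by linarith
      moreover from this have "r * ?m \<le> card (S \<inter> B)" using balance size_bounds by linarith
      ultimately show ?thesis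
        by (intro copies_in_biclique[of "T \<inter> A" _ _ _ "S \<inter> B"]) (use fin sides opp in auto)
    qed
  qed
qed

lemma monochromatic_copies: "\<exists>S. is_copy S (disjoint_copies r (path_graph l)) G \<and> monochromatic c S"
proof -
  interpret flip: coloured_biclique G c B A N k l r by (rule sides_swapped)
  consider (row) u where "u \<in> A" "card ((\<lambda>b. c {u, b}) ` B) \<ge> 3"
    | (col) u where "u \<in> B" "card ((\<lambda>a. c {u, a}) ` A) \<ge> 3"
    | (two) "\<And>a. a \<in> A \<Longrightarrow> card ((\<lambda>b. c {a, b}) ` B) \<le> 2" "\<And>b. b \<in> B \<Longrightarrow> card ((\<lambda>a. c {a, b}) ` A) \<le> 2"
    by (fastforce simp: insert_commute not_le)
  then show ?thesis
  proof cases
    case row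
    then show ?thesis by (rule copies_if_3_coloured_vertex)
  next
    case col
    then show ?thesis by (rule flip.copies_if_3_coloured_vertex)
  next
    case two
    have "card B \<ge> 3" using size_bounds(1,5) params(3) sides(6) by linarith
    then show ?thesis
      using common_colour_of_2_coloured_lines[OF rainbow_free sides(3) _ two four_colours]
        copies_if_common_colour by blast
  qed
qed

end

section \<open>The extremal colouring\<close>

text \<open>
  An edge has exactly one right endpoint \<open>Inr j\<close>, so the preimage of the edge under \<open>Inr\<close> is
  \<open>{j}\<close>. The successor makes the colours start at 1.
\<close>

definition right_index_colouring :: "nat \<Rightarrow> (nat + nat) set \<Rightarrow> nat" where
  "right_index_colouring k e = Suc (the_elem (Inr -` e) mod k)"

lemma edge_has_right_vertex:
  assumes "e \<in> edges (complete_bipartite m n)" obtains j where "Inr j \<in> e" "j < n"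
  using assms by (auto simp: complete_bipartite_def)

lemma colour_of_edge:
  assumes "e \<in> edges (complete_bipartite m n)" "Inr j \<in> e"
  shows "right_index_colouring k e = Suc (j mod k)"
proof -
  obtain i where "e = {Inl i, Inr j}" using assms by (auto simp: complete_bipartite_def)
  then have "Inr -` e = {j}" by auto
  then show ?thesis by (simp add: right_index_colouring_def)
qed

lemma card_residue_class_le:
  fixes k q t :: nat
  shows "card {j. j < k * q \<and> j mod k = t} \<le> q"
proof -
  have "inj_on (\<lambda>j. j div k) {j. j < k * q \<and> j mod k = t}"
    by (rule inj_onI) (metis (mono_tags, lifting) div_mult_mod_eq mem_Collect_eq)
  moreover have "(\<lambda>j. j div k) ` {j. j < k * q \<and> j mod k = t} \<subseteq> {..<q}"
    by (auto simp: less_mult_imp_div_less mult.commute)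
  ultimately have "card {j. j < k * q \<and> j mod k = t} \<le> card {..<q}"
    by (rule card_inj_on_le) simp
  then show ?thesis by simp
qed

lemma right_index_colouring_exact:
  assumes "0 < k" "0 < q"
  shows "exact_coloring k (complete_bipartite (k * q) (k * q)) (right_index_colouring k)"
proof -
  let ?G = "complete_bipartite (k * q) (k * q)"
  have "right_index_colouring k e \<in> {1..k}" if "e \<in> edges ?G" for e
    using edge_has_right_vertex[OF that] colour_of_edge[OF that] assms(1)
    by (metis Suc_leI atLeastAtMost_iff le_add1 mod_less_divisor plus_1_eq_Suc)
  moreover have "t \<in> right_index_colouring k ` edges ?G" if "t \<in> {1..k}" for t
  proof -
    have "k \<le> k * q" using assms by simp
    moreover have "t - 1 < k" using that assms by auto
    ultimately have "t - 1 < k * q" by linarith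
    moreover from this have "0 < k * q" by linarith
    ultimately have e: "{Inl 0, Inr (t - 1)} \<in> edges ?G"
      unfolding complete_bipartite_def ugraph.simps by blast
    have "right_index_colouring k {Inl 0, Inr (t - 1)} = t"
      using colour_of_edge[OF e, of "t - 1" k] \<open>t - 1 < k\<close> that by auto
    then show ?thesis using e by (metis imageI)
  qed
  ultimately show ?thesis unfolding exact_coloring_def by blast
qed

text \<open>
  The second or the third vertex of the path is on the right, and it lies on two edges of the
  path.
\<close>

lemma right_index_colouring_no_rainbow:
  assumes S: "is_copy S (path_graph 5) (complete_bipartite m n)"
  shows "\<not> rainbow (right_index_colouring k) S"
proof
  let ?c = "right_index_colouring k"
  assume rb: "rainbow ?c S"
  obtain f where f: "inj_on f (verts (path_graph 5))"
    and ES: "edges S = (\<lambda>e. f ` e) ` edges (path_graph 5)"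
    and sub: "edges S \<subseteq> edges (complete_bipartite m n)"
    using copy_embedding[OF S] by metis
  have V: "verts (path_graph 5) = {..<5}" by (simp add: path_graph_def)
  have E: "{f i, f (Suc i)} \<in> edges S" if "i < 4" for i
  proof -
    have "{i, Suc i} \<in> edges (path_graph 5)" using that by (auto simp: path_graph_def)
    then have "f ` {i, Suc i} \<in> edges S" unfolding ES by (rule imageI)
    then show ?thesis by simp
  qed
  have clash: False if "Inr j = f (Suc i)" "i < 3" for i j
  proof -
    have e: "{f i, f (Suc i)} \<in> edges S" "{f (Suc i), f (Suc (Suc i))} \<in> edges S" using E that by auto
    have "?c {f i, f (Suc i)} = Suc (j mod k)" "?c {f (Suc i), f (Suc (Suc i))} = Suc (j mod k)"
      using e sub that(1) by (auto intro!: colour_of_edge)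
    then have "{f i, f (Suc i)} = {f (Suc i), f (Suc (Suc i))}"
      using rb e unfolding rainbow_def inj_on_def by metis
    then have "f i = f (Suc (Suc i))" by (auto simp: doubleton_eq_iff)
    then show False using f that(2) unfolding V by (simp add: inj_on_eq_iff)
  qed
  have "{f 1, f 2} \<in> edges (complete_bipartite m n)" using E[of 1] sub by (auto simp: numeral_2_eq_2)
  then obtain j where "Inr j \<in> {f 1, f 2}" by (rule edge_has_right_vertex)
  then show False using clash[of j 0] clash[of j 1] by (auto simp: numeral_2_eq_2)
qed

text \<open>
  Every path \<open>P\<^sub>l\<close> has a matching of \<open>l div 2\<close> edges, and each edge of the matching has its own
  right vertex. So \<open>r * (l div 2)\<close> right vertices of one residue class modulo \<open>k\<close> are needed.
\<close>

lemma right_index_colouring_no_monochromatic: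
  assumes S: "is_copy S (disjoint_copies r (path_graph l)) (complete_bipartite m (k * q))"
    and q: "q < r * (l div 2)"
  shows "\<not> monochromatic (right_index_colouring k) S"
proof
  let ?c = "right_index_colouring k" and ?G = "complete_bipartite m (k * q)"
  let ?D = "{..<r} \<times> {..<l div 2}"
  assume "monochromatic ?c S"
  then obtain x where x: "\<And>e. e \<in> edges S \<Longrightarrow> ?c e = x" by (auto simp: monochromatic_def)
  obtain f where f: "inj_on f ({..<r} \<times> {..<l})"
    and ES: "edges S = (\<lambda>e. f ` e) ` edges (disjoint_copies r (path_graph l))"
    and sub: "edges S \<subseteq> edges ?G"
    using copy_embedding[OF S] unfolding verts_copies_of_path by metis
  define pair where "pair = (\<lambda>(i, s). {(i, 2 * s), (i, Suc (2 * s))} :: (nat \<times> nat) set)"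
  have "\<exists>j. Inr j \<in> f ` pair d \<and> j < k * q \<and> j mod k = x - 1" if "d \<in> ?D" for d
  proof -
    have "pair d \<in> edges (disjoint_copies r (path_graph l))"
      using that by (force simp: edges_copies_of_path pair_def)
    then have e: "f ` pair d \<in> edges S" unfolding ES by (rule imageI)
    then obtain j where j: "Inr j \<in> f ` pair d" "j < k * q"
      using sub edge_has_right_vertex by blast
    then have "x = Suc (j mod k)" using x[OF e] colour_of_edge e sub by (metis subsetD)
    then show ?thesis using j by auto
  qed
  then obtain g where g: "\<And>d. d \<in> ?D \<Longrightarrow> Inr (g d) \<in> f ` pair d \<and> g d < k * q \<and> g d mod k = x - 1"
    by metis
  have "inj_on g ?D"
  proof (rule inj_onI)
    fix d d' assume d: "d \<in> ?D" "d' \<in> ?D" and "g d = g d'"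
    then have "f ` pair d \<inter> f ` pair d' \<noteq> {}" using g by (metis disjoint_iff)
    moreover have "pair d \<subseteq> {..<r} \<times> {..<l}" "pair d' \<subseteq> {..<r} \<times> {..<l}"
      using d by (auto simp: pair_def)
    ultimately have "pair d \<inter> pair d' \<noteq> {}"
      using inj_on_image_Int[OF f] by (metis image_empty)
    then show "d = d'" by (cases d; cases d') (auto simp: pair_def; presburger)
  qed
  moreover have "g ` ?D \<subseteq> {j. j < k * q \<and> j mod k = x - 1}" using g by blast
  ultimately have "card ?D \<le> card {j. j < k * q \<and> j mod k = x - 1}"
    by (rule card_inj_on_le) simp
  then show False using card_residue_class_le[of k q "x - 1"] q by simp
qed

section \<open>The bipartite Gallai-Ramsey number\<close>

theorem theorem3p2:
  fixes k l r :: nat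
  assumes "k \<ge> 4" and "l \<ge> 10" and "r \<ge> 1"
  shows "bgr k (path_graph 5) (disjoint_copies r (path_graph l))
           = enat (k * r * (l div 2) - k + 1)"
proof -
  define p where "p = r * (l div 2)"
  have "r * 5 \<le> p" unfolding p_def using assms(2) by (intro mult_le_mono) auto
  then have p: "p \<ge> 5" using assms(3) by linarith
  have bound_eq: "k * r * (l div 2) - k + 1 = k * (p - 1) + 1"
    by (simp add: p_def diff_mult_distrib2 mult.assoc)
  show ?thesis
    unfolding bgr_eq_enat_iff bound_eq
  proof (intro conjI allI impI)
    let ?n = "k * (p - 1) + 1"
    show "bgr_bound k (path_graph 5) (disjoint_copies r (path_graph l)) ?n"
      unfolding bgr_bound_def
    proof (intro conjI allI impI)
      have "k * 1 \<le> k * (p - 1)" using p by (intro mult_le_mono) auto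
      then have "k \<le> ?n" by linarith
      also have "?n \<le> ?n\<^sup>2" by (simp only: power2_eq_square le_square)
      finally show "k \<le> ?n\<^sup>2" .
    next
      fix N c
      let ?G = "complete_bipartite N N" and ?L = "Inl ` {..<N} :: (nat + nat) set"
        and ?R = "Inr ` {..<N} :: (nat + nat) set"
      assume N: "?n \<le> N" and exact: "exact_coloring k ?G c"
      have "coloured_biclique ?G c ?L ?R N k l r"
        if "\<not> (\<exists>S. is_copy S (path_graph 5) ?G \<and> rainbow c S)"
      proof
        have "edges ?G = (\<lambda>(a, b). {a, b}) ` (?L \<times> ?R)"
          unfolding complete_bipartite_def ugraph.simps by force
        then show "(\<lambda>(a, b). c {a, b}) ` (?L \<times> ?R) = {1..k}"
          using exact by (simp add: exact_coloring_def image_image case_prod_beta)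
        show "k * (r * (l div 2) - 1) < N" using N by (simp add: p_def)
        show "{a, b} \<in> edges ?G" if "a \<in> ?L" "b \<in> ?R" for a b
          using that by (auto simp: complete_bipartite_def)
        show "?L \<union> ?R \<subseteq> verts ?G" by (auto simp: complete_bipartite_def)
      qed (use that assms in \<open>auto simp: card_image\<close>)
      then show "(\<exists>S. is_copy S (path_graph 5) ?G \<and> rainbow c S) \<or>
          (\<exists>S. is_copy S (disjoint_copies r (path_graph l)) ?G \<and> monochromatic c S)"
        using coloured_biclique.monochromatic_copies by blast
    qed
  next
    fix n assume n: "bgr_bound k (path_graph 5) (disjoint_copies r (path_graph l)) n"
    show "k * (p - 1) + 1 \<le> n"
    proof (rule ccontr)
      \<comment> \<open>If a bound \<open>n\<close> were smaller, it would apply to the extremal colouring.\<close>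
      let ?N = "k * (p - 1)" and ?c = "right_index_colouring k"
      assume "\<not> k * (p - 1) + 1 \<le> n"
      then have "n \<le> ?N" by simp
      moreover have "exact_coloring k (complete_bipartite ?N ?N) ?c"
        using right_index_colouring_exact[of k "p - 1"] assms(1) p by simp
      ultimately have
        "(\<exists>S. is_copy S (path_graph 5) (complete_bipartite ?N ?N) \<and> rainbow ?c S) \<or>
         (\<exists>S. is_copy S (disjoint_copies r (path_graph l)) (complete_bipartite ?N ?N) \<and>
            monochromatic ?c S)"
        using n unfolding bgr_bound_def by blast
      moreover have "p - 1 < r * (l div 2)" using p by (simp add: p_def)
      ultimately show False
        using right_index_colouring_no_rainbow right_index_colouring_no_monochromatic by blast
    qed
  qed
qed

end
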